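(* Let $X$ be an infinite-dimensional complex Banach space and let $T\in L(X)$. Then the following statements are equivalent: (i) $T$ satisfies property $(UW_{\Pi})$ and $\Pi_a(T)\cap\sigma_{uw}(T)=\emptyset$; (ii) $T$ satisfies property $(Z_{\Pi_a})$ and $\sigma_w(T)\setminus\sigma_{uw}(T)=\sigma(T)\setminus\sigma_a(T)$; (iii) $T$ satisfies property $(Z_{\Pi_a})$ and $\Delta_a(T)\cap\sigma_w(T)=\emptyset$.
   Context: $L(X)$ is the algebra of bounded linear operators on $X$. For $T\in L(X)$, $\alpha(T)=\dim \mathcal{N}(T)$ (kernel) and $\beta(T)=\operatorname{codim}\mathcal{R}(T)$ (range); the index is $\alpha(T)-\beta(T)$. The ascent is $p(T)=\inf\{n\in\mathbb{N}:\mathcal{N}(T^n)=\mathcal{N}(T^{n+1})\}$ and the descent is $q(T)=\inf\{n\in\mathbb{N}:\mathcal{R}(T^n)=\mathcal{R}(T^{n+1})\}$ ($n\ge 0$, $\inf\emptyset=\infty$). $\sigma(T)$ is the spectrum and $\sigma_a(T)$ the approximate point spectrum. $T$ is upper semi-Fredholm if $\mathcal{R}(T)$ is closed and $\alpha(T)<\infty$. Weyl spectrum: $\sigma_w(T)$ is the set of $\lambda\in\mathbb{C}$ such that $T-\lambda I$ is not Fredholm of index $0$. Upper semi-Weyl spectrum: $\sigma_{uw}(T)$ is the set of $\lambda$ such that $T-\lambda I$ is not an upper semi-Fredholm operator of index $\le 0$. Put $\Delta(T)=\sigma(T)\setminus\sigma_w(T)$ and $\Delta_a(T)=\sigma_a(T)\setminus\sigma_{uw}(T)$.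 $\Pi(T)$ is the set of poles of $T$: those $\lambda\in\sigma(T)$ with $p(T-\lambda I)<\infty$ and $q(T-\lambda I)<\infty$. $\Pi_a(T)$ is the set of left poles of $T$: those $\lambda\in\sigma_a(T)$ such that $p:=p(T-\lambda I)<\infty$ and $\mathcal{R}((T-\lambda I)^{p+1})$ is closed. $T$ satisfies property $(UW_{\Pi})$ if $\Delta_a(T)=\Pi(T)$; $T$ satisfies property $(Z_{\Pi_a})$ if $\Delta(T)=\Pi_a(T)$. *)

theory Defs
  imports "HOL-Analysis.Analysis"
begin

text \<open>The distribution only has real Banach spaces (class \<open>banach\<close>).  A complex Banach space is one
  whose real scalar multiplication is the restriction of a complex one compatible with the norm.\<close>

class complex_banach = banach +
  fixes scaleC :: "complex \<Rightarrow> 'a \<Rightarrow> 'a" (infixr "*\<^sub>C" 75)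
  assumes scaleC_add_right: "c *\<^sub>C (x + y) = c *\<^sub>C x + c *\<^sub>C y"
    and scaleC_add_left: "(c + d) *\<^sub>C x = c *\<^sub>C x + d *\<^sub>C x"
    and scaleC_scaleC: "c *\<^sub>C d *\<^sub>C x = (c * d) *\<^sub>C x"
    and scaleC_one: "1 *\<^sub>C x = x"
    and scaleR_scaleC: "scaleR r x = complex_of_real r *\<^sub>C x"
    and norm_scaleC: "norm (c *\<^sub>C x) = cmod c * norm x"

global_interpretation complex_vector:
  vector_space "scaleC :: complex \<Rightarrow> 'a \<Rightarrow> 'a::complex_banach"
  by unfold_locales (simp_all add: scaleC_add_right scaleC_add_left scaleC_scaleC scaleC_one)

definition finite_cdim :: "'a::complex_banach set \<Rightarrow> bool" where
  "finite_cdim V \<longleftrightarrow> (\<exists>B. finite B \<and> V \<subseteq> complex_vector.span B)"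

text \<open>\<open>complex_vector.dim\<close> may return the junk value \<open>0\<close> on infinite-dimensional subspaces, hence
  the case distinction.\<close>

definition cdim :: "'a::complex_banach set \<Rightarrow> enat" where
  "cdim V = (if finite_cdim V then enat (complex_vector.dim V) else \<infinity>)"

definition complementary :: "'a::complex_banach set \<Rightarrow> 'a set \<Rightarrow> bool" where
  "complementary M N \<longleftrightarrow> complex_vector.subspace N \<and> M \<inter> N = {0} \<and>
     (\<forall>x. \<exists>m\<in>M. \<exists>n\<in>N. x = m + n)"

text \<open>The dimension of the quotient by a subspace \<open>M\<close>, realised on an algebraic complement of
  \<open>M\<close> (no closedness is required of either).  By \<open>ex_complementary\<close> and \<open>codim_eq\<close> below a
  complement exists and its choice is irrelevant.\<close>

definition codim :: "'a::complex_banach set \<Rightarrow> enat" where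
  "codim M = cdim (SOME N. complementary M N)"

lemma ex_complementary:
  assumes M: "complex_vector.subspace M"
  shows "\<exists>N. complementary M N"
proof -
  obtain B where B: "B \<subseteq> M" "complex_vector.independent B" "M \<subseteq> complex_vector.span B"
    using complex_vector.maximal_independent_subset by blast
  have sB: "complex_vector.span B = M"
    using B M by (simp add: complex_vector.span_subspace)
  define C where "C = complex_vector.extend_basis B"
  have C: "complex_vector.independent C" "B \<subseteq> C" "complex_vector.span C = UNIV"
    using B(2) by (simp_all add: C_def complex_vector.extend_basis_superset
        complex_vector.independent_extend_basis)
  define N where "N = complex_vector.span (C - B)"
  have "v = 0" if v: "v \<in> M" "v \<in> N" for v
  proof -
    have 1: "complex_vector.representation C v = complex_vector.representation B v"
      using complex_vector.representation_extend[OF C(1) _ C(2)] v(1) sB by simp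
    have 2: "complex_vector.representation C v = complex_vector.representation (C - B) v"
      using complex_vector.representation_extend[OF C(1), of v "C - B"] v(2) N_def by auto
    have "complex_vector.representation C v b = 0" for b
      using 1 2 complex_vector.representation_ne_zero[of B v b]
        complex_vector.representation_ne_zero[of "C - B" v b] by auto
    then show ?thesis
      using complex_vector.sum_nonzero_representation_eq[OF C(1), of v] C(3) by simp
  qed
  then have "M \<inter> N = {0}"
    using M by (auto simp: N_def complex_vector.span_zero complex_vector.subspace_0)
  moreover have "\<exists>m\<in>M. \<exists>n\<in>N. x = m + n" for x
  proof -
    have "x \<in> complex_vector.span (B \<union> (C - B))"
      using C by (simp add: Un_absorb1)
    then show ?thesis
      unfolding complex_vector.span_Un sB N_def by auto
  qed
  ultimately show ?thesis
    unfolding complementary_def by (auto simp: N_def)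
qed

lemma cdim_complementary_le:
  assumes M: "complex_vector.subspace M" and N: "complementary M N" and N': "complementary M N'"
  shows "cdim N' \<le> cdim N"
proof (cases "finite_cdim N")
  case False
  then show ?thesis by (simp add: cdim_def)
next
  case True
  then obtain F where F: "finite F" "N \<subseteq> complex_vector.span F"
    unfolding finite_cdim_def by blast
  obtain B where B: "B \<subseteq> N" "complex_vector.independent B" "N \<subseteq> complex_vector.span B"
      "card B = complex_vector.dim N"
    using complex_vector.basis_exists by blast
  have finB: "finite B"
    using complex_vector.independent_span_bound[OF F(1) B(2)] B(1) F(2) by auto
  have "\<exists>y\<in>N'. b - y \<in> M" for b
    using N' unfolding complementary_def by (metis add_diff_cancel_right')
  then obtain g where g: "\<And>b. g b \<in> N'" "\<And>b. b - g b \<in> M"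
    by metis
  have sub: "complex_vector.span (g ` B) \<subseteq> N'"
    using g(1) N' by (intro complex_vector.span_minimal) (auto simp: complementary_def)
  have *: "\<exists>y\<in>complex_vector.span (g ` B). x - y \<in> M" if "x \<in> complex_vector.span B" for x
    using that
  proof (induction rule: complex_vector.span_induct_alt)
    case base
    then show ?case
      using M by (intro bexI[of _ 0]) (auto simp: complex_vector.subspace_0 complex_vector.span_zero)
  next
    case (step c x y)
    then obtain z where z: "z \<in> complex_vector.span (g ` B)" "y - z \<in> M"
      by blast
    have "c *\<^sub>C (x - g x) + (y - z) \<in> M"
      using M g(2) z(2) by (simp add: complex_vector.subspace_add complex_vector.subspace_scale)
    then have "(c *\<^sub>C x + y) - (c *\<^sub>C g x + z) \<in> M"
      by (simp add: complex_vector.scale_right_diff_distrib algebra_simps)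
    moreover have "c *\<^sub>C g x + z \<in> complex_vector.span (g ` B)"
      using step(1) z(1)
      by (simp add: complex_vector.span_add complex_vector.span_scale complex_vector.span_base)
    ultimately show ?case by blast
  qed
  have span: "N' \<subseteq> complex_vector.span (g ` B)"
  proof
    fix x assume x: "x \<in> N'"
    obtain m n where mn: "m \<in> M" "n \<in> N" "x = m + n"
      using N unfolding complementary_def by blast
    then obtain y where y: "y \<in> complex_vector.span (g ` B)" "n - y \<in> M"
      using * B(3) by blast
    have "x - y = m + (n - y)"
      using mn by simp
    then have "x - y \<in> M"
      using M mn(1) y(2) by (simp only: complex_vector.subspace_add)
    moreover have "x - y \<in> N'"
      using x y(1) sub N' by (auto simp: complementary_def intro: complex_vector.subspace_diff)
    ultimately have "x - y \<in> {0}"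
      using N' unfolding complementary_def by blast
    then have "x = y"
      by simp
    then show "x \<in> complex_vector.span (g ` B)"
      using y(1) by simp
  qed
  have "complex_vector.dim N' \<le> card (g ` B)"
    using span finB by (intro complex_vector.dim_le_card) auto
  also have "\<dots> \<le> complex_vector.dim N"
    using card_image_le[OF finB, of g] B(4) by simp
  finally show ?thesis
    using True span finB by (auto simp: cdim_def finite_cdim_def)
qed

lemma codim_eq:
  assumes "complex_vector.subspace M" "complementary M N"
  shows "codim M = cdim N"
proof -
  have "complementary M (SOME N. complementary M N)"
    using assms(2) by (rule someI)
  then show ?thesis
    unfolding codim_def using cdim_complementary_le assms by (meson antisym)
qed

definition bounded_clinear :: "('a::complex_banach \<Rightarrow> 'a) \<Rightarrow> bool" where
  "bounded_clinear T \<longleftrightarrow> bounded_linear T \<and> (\<forall>c x. T (c *\<^sub>C x) = c *\<^sub>C T x)"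

definition shift :: "('a::complex_banach \<Rightarrow> 'a) \<Rightarrow> complex \<Rightarrow> 'a \<Rightarrow> 'a" where
  "shift T l = (\<lambda>x. T x - l *\<^sub>C x)"

definition kern :: "('a::complex_banach \<Rightarrow> 'a) \<Rightarrow> 'a set" where
  "kern T = {x. T x = 0}"

definition nullity :: "('a::complex_banach \<Rightarrow> 'a) \<Rightarrow> enat" where
  "nullity T = cdim (kern T)"

definition defect :: "('a::complex_banach \<Rightarrow> 'a) \<Rightarrow> enat" where
  "defect T = codim (range T)"

text \<open>Only used when \<open>nullity T\<close> is finite, so that \<open>\<infinity> - \<infinity>\<close> does not occur; the value may be
  \<open>-\<infinity>\<close>.\<close>

definition fredholm_index :: "('a::complex_banach \<Rightarrow> 'a) \<Rightarrow> ereal" where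
  "fredholm_index T = ereal_of_enat (nullity T) - ereal_of_enat (defect T)"

text \<open>The infimum of the empty set in \<open>enat\<close> is \<open>\<infinity>\<close>.\<close>

definition ascent :: "('a::complex_banach \<Rightarrow> 'a) \<Rightarrow> enat" where
  "ascent T = Inf {enat n | n. kern (T ^^ n) = kern (T ^^ Suc n)}"

definition descent :: "('a::complex_banach \<Rightarrow> 'a) \<Rightarrow> enat" where
  "descent T = Inf {enat n | n. range (T ^^ n) = range (T ^^ Suc n)}"

definition upper_semi_Fredholm :: "('a::complex_banach \<Rightarrow> 'a) \<Rightarrow> bool" where
  "upper_semi_Fredholm T \<longleftrightarrow> closed (range T) \<and> nullity T < \<infinity>"

text \<open>Upper and lower semi-Fredholm; finite defect already forces a bounded operator on a Banach space
  to have closed range.\<close>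

definition Fredholm :: "('a::complex_banach \<Rightarrow> 'a) \<Rightarrow> bool" where
  "Fredholm T \<longleftrightarrow> upper_semi_Fredholm T \<and> defect T < \<infinity>"

definition invertible_op :: "('a::complex_banach \<Rightarrow> 'a) \<Rightarrow> bool" where
  "invertible_op T \<longleftrightarrow> (\<exists>S. bounded_clinear S \<and> S \<circ> T = id \<and> T \<circ> S = id)"

definition spectrum :: "('a::complex_banach \<Rightarrow> 'a) \<Rightarrow> complex set" where
  "spectrum T = {l. \<not> invertible_op (shift T l)}"

definition approx_point_spectrum :: "('a::complex_banach \<Rightarrow> 'a) \<Rightarrow> complex set" where
  "approx_point_spectrum T =
     {l. \<exists>x :: nat \<Rightarrow> 'a. (\<forall>n. norm (x n) = 1) \<and> (\<lambda>n. shift T l (x n)) \<longlonglongrightarrow> 0}"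

definition Weyl_spectrum :: "('a::complex_banach \<Rightarrow> 'a) \<Rightarrow> complex set" where
  "Weyl_spectrum T = {l. \<not> (Fredholm (shift T l) \<and> fredholm_index (shift T l) = 0)}"

definition upper_semi_Weyl_spectrum :: "('a::complex_banach \<Rightarrow> 'a) \<Rightarrow> complex set" where
  "upper_semi_Weyl_spectrum T =
     {l. \<not> (upper_semi_Fredholm (shift T l) \<and> fredholm_index (shift T l) \<le> 0)}"

definition Delta :: "('a::complex_banach \<Rightarrow> 'a) \<Rightarrow> complex set" where
  "Delta T = spectrum T - Weyl_spectrum T"

definition Delta_a :: "('a::complex_banach \<Rightarrow> 'a) \<Rightarrow> complex set" where
  "Delta_a T = approx_point_spectrum T - upper_semi_Weyl_spectrum T"

definition poles :: "('a::complex_banach \<Rightarrow> 'a) \<Rightarrow> complex set" where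
  "poles T = {l \<in> spectrum T. ascent (shift T l) < \<infinity> \<and> descent (shift T l) < \<infinity>}"

definition left_poles :: "('a::complex_banach \<Rightarrow> 'a) \<Rightarrow> complex set" where
  "left_poles T = {l \<in> approx_point_spectrum T.
     \<exists>p. ascent (shift T l) = enat p \<and> closed (range (shift T l ^^ (p + 1)))}"

definition property_UW_Pi :: "('a::complex_banach \<Rightarrow> 'a) \<Rightarrow> bool" where
  "property_UW_Pi T \<longleftrightarrow> Delta_a T = poles T"

definition property_Z_Pi_a :: "('a::complex_banach \<Rightarrow> 'a) \<Rightarrow> bool" where
  "property_Z_Pi_a T \<longleftrightarrow> Delta T = left_poles T"

end

theory Submission
  imports Defs
begin

text \<open>
  Write \<open>A = T - \<lambda>I\<close>.  Besides the elementary inclusions \<open>\<sigma>\<^sub>u\<^sub>w(T) \<subseteq> \<sigma>\<^sub>w(T) \<subseteq> \<sigma>(T)\<close> and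
  \<open>\<sigma>\<^sub>u\<^sub>w(T) \<subseteq> \<sigma>\<^sub>a(T) \<subseteq> \<sigma>(T)\<close>, the equivalence rests on four inclusions; once they are known, it is
  a computation with sets.

  \<^item> \<open>\<sigma>(T) - \<sigma>\<^sub>a(T) \<subseteq> \<sigma>\<^sub>w(T)\<close>: off the approximate point spectrum \<open>A\<close> is bounded below, so index
    \<open>0\<close> would make it surjective, hence invertible.  With the elementary inclusions this
    gives (ii) \<open>\<longleftrightarrow>\<close> (iii) and \<open>\<Delta>(T) \<subseteq> \<Delta>\<^sub>a(T)\<close>.
  \<^item> \<open>\<Pi>(T) \<subseteq> \<Pi>\<^sub>a(T)\<close>: at a pole the ascent \<open>p\<close> is also a point where the ranges are stationary, and
    \<open>X\<close> is the direct sum of the range and the kernel of \<open>A\<^sup>p\<close>.  By the open mapping theorem a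
    bounded operator whose range has a closed algebraic complement has closed range.
  \<^item> \<open>\<Pi>\<^sub>a(T) - \<sigma>\<^sub>w(T) \<subseteq> \<Pi>(T)\<close> and \<open>\<Pi>(T) \<inter> \<sigma>\<^sub>w(T) \<subseteq> \<sigma>\<^sub>u\<^sub>w(T)\<close>: if \<open>\<alpha>(A)\<close> is finite and the kernels of
    the powers of \<open>A\<close> are stationary from \<open>p\<close> on, then the ranges are stationary from \<open>p\<close> on if
    and only if \<open>\<alpha>(A) = \<beta>(A)\<close> (\<open>range_stable_iff_nullity_eq_defect\<close>).

  The last equivalence comes from rank-nullity on the finite-dimensional space \<open>V = N(A\<^sup>p)\<close>.  As
  \<open>N(A) \<subseteq> V\<close> and \<open>A V = V \<inter> R(A)\<close>, a complement \<open>W\<close> of \<open>V \<inter> R(A)\<close> in \<open>V\<close> has dimension \<open>\<alpha>(A)\<close>, it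
  meets \<open>R(A)\<close> trivially, and \<open>R(A) + W = R(A) + V\<close>.  Stationarity of the ranges at \<open>p\<close> says
  \<open>R(A) + V = X\<close>, that is, \<open>W\<close> is a full complement of \<open>R(A)\<close>, and by counting dimensions this
  is the case exactly when \<open>\<alpha>(A) = \<beta>(A)\<close>.
\<close>

section \<open>Dimensions of complex subspaces\<close>

abbreviation clinear :: "('a::complex_banach \<Rightarrow> 'a) \<Rightarrow> bool" where
  "clinear A \<equiv> Vector_Spaces.linear scaleC scaleC A"

definition subspace_sum :: "'a::ab_group_add set \<Rightarrow> 'a set \<Rightarrow> 'a set" where
  "subspace_sum M N = {x + y |x y. x \<in> M \<and> y \<in> N}"

lemma subspace_subspace_sum:
  assumes "complex_vector.subspace M" "complex_vector.subspace N"
  shows "complex_vector.subspace (subspace_sum M N)"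
  unfolding subspace_sum_def using assms by (rule complex_vector.subspace_sums)

lemma subset_subspace_sum_right:
  assumes "complex_vector.subspace M"
  shows "N \<subseteq> subspace_sum M N"
  unfolding subspace_sum_def
  using complex_vector.subspace_0[OF assms] by (auto intro: add_0_left[symmetric])

lemma complementary_iff_subspace_sum:
  "complementary M N \<longleftrightarrow>
     complex_vector.subspace N \<and> M \<inter> N = {0} \<and> subspace_sum M N = UNIV"
proof -
  have "(\<exists>m\<in>M. \<exists>n\<in>N. x = m + n) \<longleftrightarrow> x \<in> subspace_sum M N" for x
    unfolding subspace_sum_def by blast
  then have "(\<forall>x. \<exists>m\<in>M. \<exists>n\<in>N. x = m + n) \<longleftrightarrow> subspace_sum M N = UNIV"
    by (simp add: set_eq_iff)
  then show ?thesis
    unfolding complementary_def by simp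
qed

lemma subspace_basis:
  assumes "complex_vector.subspace M"
  obtains B where "complex_vector.independent B" "complex_vector.span B = M"
proof -
  obtain B where "B \<subseteq> M" "complex_vector.independent B" "M \<subseteq> complex_vector.span B"
    using complex_vector.maximal_independent_subset by blast
  then show thesis
    using that complex_vector.span_subspace[OF _ _ assms] by blast
qed

text \<open>Bridge from bases to \<open>cdim\<close>, valid also for infinite bases, so that additivity and
  rank-nullity below hold with values in \<open>enat\<close>.\<close>

lemma cdim_span_independent:
  assumes "complex_vector.independent B"
  shows "cdim (complex_vector.span B) = (if finite B then enat (card B) else \<infinity>)"
proof (cases "finite B")
  case True
  then show ?thesis
    using assms by (auto simp: cdim_def finite_cdim_def complex_vector.dim_eq_card_independent)
next
  case False
  have "\<not> finite_cdim (complex_vector.span B)"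
    using False assms complex_vector.independent_span_bound complex_vector.span_superset[of B]
    unfolding finite_cdim_def by blast
  then show ?thesis
    using False by (simp add: cdim_def)
qed

lemma cdim_eq_0D:
  assumes "complex_vector.subspace M" "cdim M = 0"
  shows "M = {0}"
proof -
  obtain B where B: "complex_vector.independent B" "complex_vector.span B = M"
    using subspace_basis[OF assms(1)] .
  have "B = {}"
    using assms(2) cdim_span_independent[OF B(1)] B(2)
    by (auto simp: zero_enat_def split: if_splits)
  then show ?thesis
    using B(2) by simp
qed

text \<open>If \<open>a \<in> B\<close> were a combination of the other vectors of \<open>B \<union> C\<close>, moving its \<open>B\<close>-part to the
  other side would give a vector in both spans, so the \<open>C\<close>-part would vanish.\<close>

lemma independent_Un_of_span_Int:
  assumes B: "complex_vector.independent B" and C: "complex_vector.independent C"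
    and BC: "complex_vector.span B \<inter> complex_vector.span C = {0}"
  shows "complex_vector.independent (B \<union> C)"
proof -
  have key: "a \<notin> complex_vector.span ((B - {a}) \<union> C)"
    if a: "a \<in> B" and B: "complex_vector.independent B"
      and BC: "complex_vector.span B \<inter> complex_vector.span C = {0}" for a and B C :: "'a set"
  proof
    assume "a \<in> complex_vector.span ((B - {a}) \<union> C)"
    then obtain b c where bc: "b \<in> complex_vector.span (B - {a})"
        "c \<in> complex_vector.span C" "a = b + c"
      unfolding complex_vector.span_Un by auto
    have "b \<in> complex_vector.span B"
      using bc(1) complex_vector.span_mono[of "B - {a}" B] by auto
    then have "a - b \<in> complex_vector.span B"
      using a by (simp add: complex_vector.span_base complex_vector.span_diff)
    then have "c \<in> complex_vector.span B \<inter> complex_vector.span C"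
      using bc by simp
    then have "a \<in> complex_vector.span (B - {a})"
      using bc BC by auto
    then show False
      using a B complex_vector.dependent_def by blast
  qed
  have disj: "B \<inter> C = {}"
  proof -
    have "b \<noteq> 0" if "b \<in> B" for b
      using B complex_vector.dependent_zero that by auto
    then show ?thesis
      using BC complex_vector.span_base by blast
  qed
  have "a \<notin> complex_vector.span (B \<union> C - {a})" if "a \<in> B \<union> C" for a
  proof (cases "a \<in> B")
    case True
    then have "B \<union> C - {a} = (B - {a}) \<union> C"
      using disj by auto
    then show ?thesis
      using key[OF True B BC] by simp
  next
    case False
    then have "a \<in> C" "B \<union> C - {a} = (C - {a}) \<union> B"
      using disj that by auto
    then show ?thesis
      using key[of a C B] C BC by (simp add: Int_commute)
  qed
  then show ?thesis
    unfolding complex_vector.dependent_def by blast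
qed

lemma cdim_direct_sum:
  assumes M: "complex_vector.subspace M" and N: "complex_vector.subspace N"
    and MN: "M \<inter> N = {0}"
  shows "cdim (subspace_sum M N) = cdim M + cdim N"
proof -
  obtain B where B: "complex_vector.independent B" "complex_vector.span B = M"
    using subspace_basis[OF M] .
  obtain C where C: "complex_vector.independent C" "complex_vector.span C = N"
    using subspace_basis[OF N] .
  have ind: "complex_vector.independent (B \<union> C)"
    using B C MN by (intro independent_Un_of_span_Int) auto
  have "subspace_sum M N = complex_vector.span (B \<union> C)"
    using B C by (simp add: complex_vector.span_Un subspace_sum_def)
  moreover have "B \<inter> C = {}"
  proof -
    have "b \<noteq> 0" if "b \<in> B" for b
      using B complex_vector.dependent_zero that by auto
    then show ?thesis
      using MN B C complex_vector.span_base by blast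
  qed
  ultimately show ?thesis
    using cdim_span_independent[OF ind] cdim_span_independent[OF B(1)]
      cdim_span_independent[OF C(1)] B C
    by (simp add: card_Un_disjoint)
qed

lemma finite_cdim_subset: "finite_cdim N \<Longrightarrow> M \<subseteq> N \<Longrightarrow> finite_cdim M"
  unfolding finite_cdim_def using subset_trans by metis

lemma cdim_less_infinity_iff: "cdim M < \<infinity> \<longleftrightarrow> finite_cdim M"
  by (simp add: cdim_def)

text \<open>Modular law: intersecting an algebraic complement of \<open>U\<close> in the whole space with
  \<open>V \<supseteq> U\<close> gives a complement of \<open>U\<close> in \<open>V\<close>.\<close>

lemma relative_complement:
  assumes V: "complex_vector.subspace V" and U: "complex_vector.subspace U" and UV: "U \<subseteq> V"
  obtains W where "complex_vector.subspace W" "W \<subseteq> V" "U \<inter> W = {0}" "subspace_sum U W = V"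
proof -
  obtain N where N: "complex_vector.subspace N" "U \<inter> N = {0}" "subspace_sum U N = UNIV"
    using ex_complementary[OF U] by (auto simp: complementary_iff_subspace_sum)
  have "x \<in> subspace_sum U (N \<inter> V)" if x: "x \<in> V" for x
  proof -
    obtain u n where un: "u \<in> U" "n \<in> N" "x = u + n"
      using N(3) unfolding subspace_sum_def by blast
    have "x - u \<in> V"
      using x un(1) UV V by (auto intro: complex_vector.subspace_diff)
    then show ?thesis
      using un unfolding subspace_sum_def by auto
  qed
  moreover have "subspace_sum U (N \<inter> V) \<subseteq> V"
    using UV V by (auto simp: subspace_sum_def intro!: complex_vector.subspace_add)
  moreover have "U \<inter> (N \<inter> V) = {0}"
    using N(2) UV by blast
  ultimately show thesis
    using that[OF complex_vector.subspace_inter[OF N(1) V]] by blast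
qed

lemma cdim_image_of_trivial_kern:
  assumes A: "clinear A" and W: "complex_vector.subspace W" and k: "W \<inter> kern A = {0}"
  shows "cdim (A ` W) = cdim W"
proof -
  interpret A: Vector_Spaces.linear scaleC scaleC A by (fact A)
  obtain B where B: "complex_vector.independent B" "complex_vector.span B = W"
    using subspace_basis[OF W] .
  have inj: "inj_on A W"
    using k by (auto simp: A.inj_on_iff_eq_0[OF W] kern_def)
  then have "complex_vector.independent (A ` B)"
    using A.independent_injective_image[OF B(1)] B(2) by simp
  moreover have "complex_vector.span (A ` B) = A ` W"
    using A.span_image B(2) by simp
  moreover have "inj_on A B"
    using inj B(2) complex_vector.span_superset inj_on_subset by blast
  ultimately show ?thesis
    using cdim_span_independent[of "A ` B"] cdim_span_independent[OF B(1)] B(2)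
    by (simp add: card_image finite_image_iff)
qed

lemma subspace_kern:
  assumes "clinear A"
  shows "complex_vector.subspace (kern A)"
proof -
  interpret A: Vector_Spaces.linear scaleC scaleC A by (fact assms)
  show ?thesis
    unfolding kern_def by (rule A.subspace_kernel)
qed

lemma subspace_image:
  assumes "clinear A" "complex_vector.subspace V"
  shows "complex_vector.subspace (A ` V)"
proof -
  interpret A: Vector_Spaces.linear scaleC scaleC A by (fact assms(1))
  show ?thesis
    using assms(2) by (rule A.subspace_image)
qed

text \<open>The operator is injective on a complement of \<open>V \<inter> kern A\<close> in \<open>V\<close>, which has the same image as
  \<open>V\<close>.\<close>

lemma rank_nullity:
  assumes A: "clinear A" and V: "complex_vector.subspace V"
  shows "cdim V = cdim (V \<inter> kern A) + cdim (A ` V)"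
proof -
  interpret A: Vector_Spaces.linear scaleC scaleC A by (fact A)
  have K: "complex_vector.subspace (V \<inter> kern A)"
    using V subspace_kern[OF A] by (rule complex_vector.subspace_inter)
  obtain W where W: "complex_vector.subspace W" "W \<subseteq> V" "V \<inter> kern A \<inter> W = {0}"
      "subspace_sum (V \<inter> kern A) W = V"
    using relative_complement[OF V K] by auto
  have "A ` V = A ` W"
  proof
    show "A ` V \<subseteq> A ` W"
    proof
      fix y assume "y \<in> A ` V"
      then obtain x where x: "x \<in> V" "y = A x"
        by blast
      then obtain u w where "u \<in> kern A" "w \<in> W" "x = u + w"
        using W(4) unfolding subspace_sum_def by blast
      then show "y \<in> A ` W"
        using x by (auto simp: A.add kern_def)
    qed
  qed (use W(2) in auto)
  moreover have "W \<inter> kern A = {0}"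
    using W(2,3) by blast
  ultimately have "cdim (A ` V) = cdim W"
    using cdim_image_of_trivial_kern[OF A W(1)] by simp
  then show ?thesis
    using cdim_direct_sum[OF K W(1,3)] W(4) by simp
qed

text \<open>Complete \<open>W\<close> by some \<open>N\<close> to a complement \<open>W + N\<close> of \<open>M\<close>.  All complements have the same
  dimension, and finiteness allows cancelling \<open>cdim W\<close>, so \<open>N\<close> is trivial.\<close>

lemma complementary_if_cdim_eq_codim:
  assumes M: "complex_vector.subspace M" and W: "complex_vector.subspace W"
    and MW: "M \<inter> W = {0}" and eq: "codim M = cdim W" and fin: "cdim W < \<infinity>"
  shows "complementary M W"
proof -
  have S: "complex_vector.subspace (subspace_sum M W)"
    using M W by (rule subspace_subspace_sum)
  obtain N where N: "complex_vector.subspace N" "subspace_sum M W \<inter> N = {0}"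
      "subspace_sum (subspace_sum M W) N = UNIV"
    using ex_complementary[OF S] by (auto simp: complementary_iff_subspace_sum)
  have WN: "W \<inter> N = {0}"
    using N(2) subset_subspace_sum_right[OF M] W N(1) by (auto simp: complex_vector.subspace_0)
  have "M \<inter> subspace_sum W N = {0}"
  proof
    show "M \<inter> subspace_sum W N \<subseteq> {0}"
    proof
      fix x assume "x \<in> M \<inter> subspace_sum W N"
      then obtain w n where x: "x \<in> M" and wn: "w \<in> W" "n \<in> N" "x = w + n"
        unfolding subspace_sum_def by blast
      have "n = x + (- w)"
        using wn by simp
      then have "n \<in> subspace_sum M W"
        using x wn(1) W unfolding subspace_sum_def
        by (blast intro: complex_vector.subspace_neg)
      then have "n = 0"
        using N(2) wn(2) by blast
      then show "x \<in> {0}"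
        using x wn MW by auto
    qed
  qed (use M subspace_subspace_sum[OF W N(1)] in \<open>auto simp: complex_vector.subspace_0\<close>)
  moreover have "subspace_sum M (subspace_sum W N) = UNIV"
    using N(3) unfolding subspace_sum_def by (auto simp: set_eq_iff) (metis add.assoc)
  ultimately have "complementary M (subspace_sum W N)"
    using subspace_subspace_sum[OF W N(1)] by (simp add: complementary_iff_subspace_sum)
  then have "cdim W = cdim W + cdim N"
    using codim_eq[OF M] eq cdim_direct_sum[OF W N(1) WN] by metis
  then have "cdim N = 0"
    using fin by (cases "cdim W"; cases "cdim N") (auto simp: zero_enat_def)
  then have "N = {0}"
    using cdim_eq_0D N(1) by blast
  then have "subspace_sum M W = UNIV"
    using N(3) unfolding subspace_sum_def by auto
  then show ?thesis
    using W MW by (simp add: complementary_iff_subspace_sum)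
qed

section \<open>Kernels and ranges of powers\<close>

lemma clinear_funpow: "clinear A \<Longrightarrow> clinear (A ^^ n)"
proof (induction n)
  case 0
  then show ?case
    using complex_vector.linear_id by (simp add: id_def)
next
  case (Suc n)
  then show ?case
    using Vector_Spaces.linear_compose[of _ _ "A ^^ n" _ A] by (simp add: comp_def)
qed

lemma kern_funpow_stable:
  assumes A: "kern (A ^^ n) = kern (A ^^ Suc n)" and "n \<le> m"
  shows "kern (A ^^ m) = kern (A ^^ n)"
  using \<open>n \<le> m\<close>
proof (induction rule: dec_induct)
  case (step m)
  have "(A ^^ Suc m) x = 0 \<longleftrightarrow> (A ^^ m) x = 0" for x
  proof -
    have s: "Suc m = Suc n + (m - n)" "m = n + (m - n)"
      using step by auto
    have "(A ^^ Suc n) ((A ^^ (m - n)) x) = 0 \<longleftrightarrow> (A ^^ n) ((A ^^ (m - n)) x) = 0"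
      using A unfolding kern_def by blast
    then show ?thesis
      using s funpow_add[of "Suc n" "m - n" A] funpow_add[of n "m - n" A] by (metis comp_apply)
  qed
  then show ?case
    using step.IH by (auto simp: kern_def)
qed simp

lemma range_funpow_stable:
  fixes A :: "'a \<Rightarrow> 'a"
  assumes A: "range (A ^^ n) = range (A ^^ Suc n)" and "n \<le> m"
  shows "range (A ^^ m) = range (A ^^ n)"
  using \<open>n \<le> m\<close>
proof (induction rule: dec_induct)
  case (step m)
  have "range (A ^^ Suc m) = A ` range (A ^^ m)"
    by (simp add: image_comp)
  also have "\<dots> = A ` range (A ^^ n)"
    using step.IH by simp
  also have "\<dots> = range (A ^^ Suc n)"
    by (simp add: image_comp)
  finally show ?case
    using A by simp
qed simp

text \<open>With \<open>m = max p q\<close> stationarity of the ranges solves \<open>A\<^sup>m y = A\<^sup>m\<^sup>+\<^sup>1 z\<close>; as the kernels of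
  \<open>A\<^sup>m\<close> and \<open>A\<^sup>p\<close> agree, the exponents can be lowered to \<open>p\<close>.  So a finite descent never exceeds a
  finite ascent.\<close>

lemma range_stable_if_kern_stable:
  assumes A: "clinear A" and k: "kern (A ^^ p) = kern (A ^^ Suc p)"
    and r: "range (A ^^ q) = range (A ^^ Suc q)"
  shows "range (A ^^ p) = range (A ^^ Suc p)"
proof
  define m where "m = max p q"
  interpret Am: Vector_Spaces.linear scaleC scaleC "A ^^ m"
    using A by (rule clinear_funpow)
  interpret Ap: Vector_Spaces.linear scaleC scaleC "A ^^ p"
    using A by (rule clinear_funpow)
  have km: "kern (A ^^ m) = kern (A ^^ p)"
    by (rule kern_funpow_stable[OF k]) (simp add: m_def)
  have rm: "range (A ^^ m) = range (A ^^ Suc m)"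
    using range_funpow_stable[OF r, of m] range_funpow_stable[OF r, of "Suc m"]
    unfolding m_def by (metis le_SucI max.cobounded2)
  show "range (A ^^ p) \<subseteq> range (A ^^ Suc p)"
  proof
    fix x assume "x \<in> range (A ^^ p)"
    then obtain y where y: "x = (A ^^ p) y" by blast
    obtain z where "(A ^^ m) y = (A ^^ Suc m) z"
      using rm by blast
    then have "y - A z \<in> kern (A ^^ m)"
      by (simp add: kern_def Am.diff funpow_swap1)
    then have "y - A z \<in> kern (A ^^ p)"
      using km by simp
    then have "(A ^^ p) y = (A ^^ p) (A z)"
      by (simp add: kern_def Ap.diff)
    then have "x = (A ^^ Suc p) z"
      using y by (simp add: funpow_swap1)
    then show "x \<in> range (A ^^ Suc p)"
      by blast
  qed
  show "range (A ^^ Suc p) \<subseteq> range (A ^^ p)"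
    by (auto simp: funpow_swap1)
qed

text \<open>Fitting decomposition: writing \<open>A\<^sup>p x = A\<^sup>2\<^sup>p z\<close> splits \<open>x\<close> as \<open>A\<^sup>p z + (x - A\<^sup>p z)\<close>, and
  \<open>kern A\<^sup>2\<^sup>p = kern A\<^sup>p\<close> makes the sum direct.\<close>

lemma range_funpow_complementary_kern:
  assumes A: "clinear A" and k: "kern (A ^^ p) = kern (A ^^ Suc p)"
    and r: "range (A ^^ p) = range (A ^^ Suc p)"
  shows "complementary (range (A ^^ p)) (kern (A ^^ p))"
proof -
  interpret Ap: Vector_Spaces.linear scaleC scaleC "A ^^ p"
    using A by (rule clinear_funpow)
  have k2: "kern (A ^^ (p + p)) = kern (A ^^ p)"
    by (rule kern_funpow_stable[OF k]) simp
  have r2: "range (A ^^ (p + p)) = range (A ^^ p)"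
    by (rule range_funpow_stable[OF r]) simp
  have "x = 0" if x: "x \<in> range (A ^^ p)" "x \<in> kern (A ^^ p)" for x
  proof -
    obtain y where y: "x = (A ^^ p) y"
      using x(1) by blast
    then have "y \<in> kern (A ^^ (p + p))"
      using x(2) by (simp add: kern_def funpow_add)
    then have "y \<in> kern (A ^^ p)"
      using k2 by simp
    then show ?thesis
      using y by (simp add: kern_def)
  qed
  moreover have "\<exists>m\<in>range (A ^^ p). \<exists>n\<in>kern (A ^^ p). x = m + n" for x
  proof -
    obtain z where "(A ^^ p) x = (A ^^ (p + p)) z"
      using r2 by blast
    then have "x - (A ^^ p) z \<in> kern (A ^^ p)"
      by (simp add: kern_def funpow_add Ap.diff)
    then show ?thesis
      by (metis add.commute diff_add_cancel rangeI)
  qed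
  moreover have "0 \<in> range (A ^^ p) \<inter> kern (A ^^ p)"
    using Ap.zero by (auto simp: kern_def intro: range_eqI[of 0 _ 0])
  ultimately show ?thesis
    unfolding complementary_def using subspace_kern[OF clinear_funpow[OF A]] by blast
qed

lemma Inf_enat_Collect:
  assumes "Inf {enat n |n. P n} = enat p"
  shows "P p"
proof -
  have ne: "{enat n |n. P n} \<noteq> {}"
  proof
    assume "{enat n |n. P n} = {}"
    then show False
      using assms by (simp only: Inf_enat_def) simp
  qed
  then obtain x where "x \<in> {enat n |n. P n}"
    by blast
  then have "(LEAST x. x \<in> {enat n |n. P n}) \<in> {enat n |n. P n}"
    by (rule LeastI)
  then have "Inf {enat n |n. P n} \<in> {enat n |n. P n}"
    unfolding Inf_enat_def using ne by simp
  then show ?thesis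
    unfolding assms by blast
qed

lemma Inf_enat_Collect_finite: "Inf {enat n |n. P n} < \<infinity> \<longleftrightarrow> (\<exists>n. P n)"
proof
  assume "Inf {enat n |n. P n} < \<infinity>"
  then show "\<exists>n. P n"
    using Inf_enat_Collect by fastforce
next
  assume "\<exists>n. P n"
  then obtain n where "P n" by blast
  then have "Inf {enat n |n. P n} \<le> enat n"
    by (auto intro: Inf_lower)
  then show "Inf {enat n |n. P n} < \<infinity>"
    using enat_ord_code(4) order_le_less_trans by blast
qed

lemma ascent_finite_iff: "ascent A < \<infinity> \<longleftrightarrow> (\<exists>n. kern (A ^^ n) = kern (A ^^ Suc n))"
  unfolding ascent_def by (rule Inf_enat_Collect_finite)

lemma descent_finite_iff: "descent A < \<infinity> \<longleftrightarrow> (\<exists>n. range (A ^^ n) = range (A ^^ Suc n))"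
  unfolding descent_def by (rule Inf_enat_Collect_finite)

lemma kern_stable_at_ascent:
  assumes "ascent A = enat p"
  shows "kern (A ^^ p) = kern (A ^^ Suc p)"
  using assms unfolding ascent_def by (rule Inf_enat_Collect)

text \<open>\<open>A\<close> maps the kernel of \<open>A\<^sup>n\<^sup>+\<^sup>1\<close> into that of \<open>A\<^sup>n\<close>, so by rank-nullity each step adds at most
  \<open>nullity A\<close> to the dimension.\<close>

lemma finite_cdim_kern_funpow:
  assumes A: "clinear A" and fin: "nullity A < \<infinity>"
  shows "cdim (kern (A ^^ n)) < \<infinity>"
proof (induction n)
  case 0
  have "kern (A ^^ 0) \<subseteq> complex_vector.span {}"
    by (auto simp: kern_def)
  then show ?case
    unfolding cdim_less_infinity_iff finite_cdim_def by blast
next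
  case (Suc n)
  have "A ` kern (A ^^ Suc n) \<subseteq> kern (A ^^ n)"
    by (auto simp: kern_def funpow_swap1)
  then have "cdim (A ` kern (A ^^ Suc n)) < \<infinity>"
    using Suc finite_cdim_subset unfolding cdim_less_infinity_iff by blast
  moreover have "cdim (kern (A ^^ Suc n) \<inter> kern A) < \<infinity>"
    using fin finite_cdim_subset unfolding cdim_less_infinity_iff nullity_def by blast
  ultimately show ?case
    using rank_nullity[OF A subspace_kern[OF clinear_funpow[OF A]], of "Suc n"]
    by (metis plus_eq_infty_iff_enat enat_ord_simps(4))
qed

text \<open>The space \<open>W\<close> is a complement of \<open>V \<inter> range A\<close> in \<open>V = kern (A ^^ p)\<close>.  Stationarity of the
  kernels gives \<open>A ` V = V \<inter> range A\<close>, so rank-nullity on \<open>V\<close> identifies its dimension.\<close>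

lemma kern_complement_range:
  assumes A: "clinear A" and fin: "nullity A < \<infinity>"
    and k: "kern (A ^^ p) = kern (A ^^ Suc p)"
  obtains W where "complex_vector.subspace W" "range A \<inter> W = {0}" "cdim W = nullity A"
    "subspace_sum (range A) W = subspace_sum (range A) (kern (A ^^ p))"
proof -
  interpret A: Vector_Spaces.linear scaleC scaleC A by (fact A)
  define V where "V = kern (A ^^ p)"
  have V: "complex_vector.subspace V"
    unfolding V_def by (intro subspace_kern clinear_funpow A)
  have R: "complex_vector.subspace (range A)"
    using A by (intro subspace_image) auto
  have "kern A \<subseteq> kern (A ^^ Suc p)"
    using module_hom.zero[of scaleC scaleC "A ^^ p"] clinear_funpow[OF A, of p]
    by (auto simp: kern_def funpow_swap1 module_hom_iff_linear)
  then have kV: "V \<inter> kern A = kern A"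
    using k by (auto simp: V_def)
  have AV: "A ` V = V \<inter> range A"
  proof
    show "A ` V \<subseteq> V \<inter> range A"
      using k by (auto simp: V_def kern_def funpow_swap1 A.zero)
    show "V \<inter> range A \<subseteq> A ` V"
    proof
      fix x assume "x \<in> V \<inter> range A"
      then obtain y where y: "x = A y" "(A ^^ p) (A y) = 0"
        by (auto simp: V_def kern_def)
      then have "y \<in> kern (A ^^ Suc p)"
        by (simp add: kern_def funpow_swap1)
      then show "x \<in> A ` V"
        using k y by (simp add: V_def)
    qed
  qed
  have U: "complex_vector.subspace (V \<inter> range A)"
    using V R by (rule complex_vector.subspace_inter)
  obtain W where W: "complex_vector.subspace W" "W \<subseteq> V" "V \<inter> range A \<inter> W = {0}"
      "subspace_sum (V \<inter> range A) W = V"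
    using relative_complement[OF V U] by auto
  have "nullity A + cdim (V \<inter> range A) = cdim (V \<inter> range A) + cdim W"
    using rank_nullity[OF A V] kV AV cdim_direct_sum[OF U W(1,3)] W(4) by (simp add: nullity_def)
  moreover have "cdim (V \<inter> range A) < \<infinity>"
    using finite_cdim_kern_funpow[OF A fin, of p] finite_cdim_subset
    unfolding cdim_less_infinity_iff V_def by blast
  ultimately have "cdim W = nullity A"
    by (metis add.commute enat_add_left_cancel less_infinityE enat.distinct(1))
  moreover have "subspace_sum (range A) W = subspace_sum (range A) V"
  proof
    show "subspace_sum (range A) W \<subseteq> subspace_sum (range A) V"
      using W(2) unfolding subspace_sum_def by blast
    show "subspace_sum (range A) V \<subseteq> subspace_sum (range A) W"
    proof
      fix x assume "x \<in> subspace_sum (range A) V"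
      then obtain r v where r: "r \<in> range A" and v: "v \<in> V" and x: "x = r + v"
        unfolding subspace_sum_def by blast
      have "v \<in> subspace_sum (V \<inter> range A) W"
        using v W(4) by simp
      then obtain u w where uw: "u \<in> range A" "w \<in> W" "v = u + w"
        unfolding subspace_sum_def by blast
      have "r + u \<in> range A"
        using R r uw(1) by (rule complex_vector.subspace_add)
      moreover have "x = (r + u) + w"
        using x uw(3) by (simp add: add.assoc)
      ultimately show "x \<in> subspace_sum (range A) W"
        using uw(2) unfolding subspace_sum_def by blast
    qed
  qed
  moreover have "range A \<inter> W = {0}"
    using W(2,3) by blast
  ultimately show thesis
    using that W(1) by (simp add: V_def)
qed

text \<open>Both sides say that every \<open>x\<close> admits some \<open>z\<close> with \<open>A\<^sup>p x = A\<^sup>p (A z)\<close>.\<close>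

lemma range_stable_iff_sum:
  assumes A: "clinear A"
  shows "range (A ^^ p) = range (A ^^ Suc p) \<longleftrightarrow> subspace_sum (range A) (kern (A ^^ p)) = UNIV"
proof
  interpret Ap: Vector_Spaces.linear scaleC scaleC "A ^^ p"
    using A by (rule clinear_funpow)
  show "subspace_sum (range A) (kern (A ^^ p)) = UNIV" if r: "range (A ^^ p) = range (A ^^ Suc p)"
  proof -
    have "x \<in> subspace_sum (range A) (kern (A ^^ p))" for x
    proof -
      obtain z where "(A ^^ p) x = (A ^^ Suc p) z"
        using r by blast
      then have "x - A z \<in> kern (A ^^ p)"
        by (simp add: kern_def Ap.diff funpow_swap1)
      moreover have "x = A z + (x - A z)"
        by simp
      ultimately show ?thesis
        unfolding subspace_sum_def by blast
    qed
    then show ?thesis by blast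
  qed
  show "range (A ^^ p) = range (A ^^ Suc p)" if s: "subspace_sum (range A) (kern (A ^^ p)) = UNIV"
  proof
    show "range (A ^^ Suc p) \<subseteq> range (A ^^ p)"
      by (auto simp: funpow_swap1)
    show "range (A ^^ p) \<subseteq> range (A ^^ Suc p)"
    proof
      fix y assume "y \<in> range (A ^^ p)"
      then obtain x where x: "y = (A ^^ p) x" by blast
      obtain z n where "x = A z + n" "n \<in> kern (A ^^ p)"
        using s unfolding subspace_sum_def by blast
      then have "y = (A ^^ Suc p) z"
        using x by (simp add: Ap.add kern_def funpow_swap1)
      then show "y \<in> range (A ^^ Suc p)" by blast
    qed
  qed
qed

text \<open>The space \<open>W\<close> of dimension \<open>nullity A\<close> that meets \<open>range A\<close> trivially is a complement of
  \<open>range A\<close> if and only if the ranges are stationary at \<open>p\<close>, and if and only if its dimension is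
  the codimension of \<open>range A\<close>.\<close>

lemma range_stable_iff_nullity_eq_defect:
  assumes A: "clinear A" and fin: "nullity A < \<infinity>"
    and k: "kern (A ^^ p) = kern (A ^^ Suc p)"
  shows "range (A ^^ p) = range (A ^^ Suc p) \<longleftrightarrow> nullity A = defect A"
proof -
  have R: "complex_vector.subspace (range A)"
    using A by (intro subspace_image) auto
  obtain W where W: "complex_vector.subspace W" "range A \<inter> W = {0}" "cdim W = nullity A"
    "subspace_sum (range A) W = subspace_sum (range A) (kern (A ^^ p))"
    using kern_complement_range[OF A fin k] .
  have "complementary (range A) W \<longleftrightarrow> nullity A = defect A"
    using codim_eq[OF R, of W] complementary_if_cdim_eq_codim[OF R W(1,2)] W(3) fin
    by (auto simp: defect_def)
  then show ?thesis
    using W unfolding range_stable_iff_sum[OF A] complementary_iff_subspace_sum by simp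
qed

section \<open>Open mappings and closed ranges\<close>

text \<open>The Baire category half of the open mapping theorem.  The target is the union of the closures of
  the images of balls of integer radius in \<open>K\<close>, so one of them contains a ball around some \<open>y0\<close>.
  Taking differences moves this ball to the origin, and scaling covers all vectors.\<close>

lemma surj_approximate_preimage:
  fixes f :: "'a::real_normed_vector \<Rightarrow> 'b::banach"
  assumes f: "bounded_linear f" and K: "subspace K" and surj: "f ` K = UNIV"
  obtains c where "c \<ge> 0" "\<And>y. \<exists>x\<in>K. norm x \<le> c * norm y \<and> norm (y - f x) \<le> norm y / 2"
proof -
  interpret f: bounded_linear f by (fact f)
  define F where "F n = closure (f ` (K \<inter> cball 0 (real n)))" for n
  have "\<exists>n. interior (F n) \<noteq> {}"
  proof (rule ccontr)
    assume "\<not> ?thesis"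
    then have "euclidean interior_of \<Union>(range F) = {}"
      by (intro Baire_category_alt)
        (auto simp: completely_metrizable_space_euclidean F_def)
    moreover have "\<Union>(range F) = UNIV"
    proof -
      have "y \<in> \<Union>(range F)" for y
      proof -
        obtain x where x: "x \<in> K" "y = f x"
          using surj by blast
        then have "y \<in> F (nat \<lceil>norm x\<rceil>)"
          unfolding F_def by (intro subsetD[OF closure_subset]) (auto simp: real_nat_ceiling_ge)
        then show ?thesis by blast
      qed
      then show ?thesis by blast
    qed
    ultimately show False by simp
  qed
  then obtain n y0 where "y0 \<in> interior (F n)" by blast
  then obtain r where r: "r > 0" "cball y0 r \<subseteq> F n"
    by (meson mem_interior_cball)
  \<comment> \<open>Both \<open>y0\<close> and \<open>y0 + y\<close> lie in \<open>F n\<close>; two errors of \<open>r / 4\<close> make up the \<open>r / 2\<close>.\<close>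
  have small: "\<exists>x\<in>K. norm x \<le> 2 * real n \<and> norm (y - f x) \<le> r / 2" if y: "norm y = r" for y
  proof -
    have "y0 \<in> F n" "y0 + y \<in> F n"
      using r y by (auto intro!: subsetD[OF r(2)] simp: dist_norm)
    moreover have "r / 4 > 0"
      using r(1) by simp
    ultimately have "\<exists>v\<in>f ` (K \<inter> cball 0 (real n)). dist v y0 < r / 4"
        "\<exists>v\<in>f ` (K \<inter> cball 0 (real n)). dist v (y0 + y) < r / 4"
      unfolding F_def closure_approachable by blast+
    then obtain a b where a: "a \<in> K" "norm a \<le> real n" "dist (f a) y0 < r / 4"
      and b: "b \<in> K" "norm b \<le> real n" "dist (f b) (y0 + y) < r / 4"
      by auto
    have "norm (b - a) \<le> 2 * real n"
      using norm_triangle_ineq4[of b a] a b by simp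
    moreover have "norm (y - f (b - a)) \<le> r / 2"
    proof -
      have eq: "y - f (b - a) = (f a - y0) - (f b - (y0 + y))"
        by (simp add: f.diff)
      have "norm (y - f (b - a)) \<le> norm (f a - y0) + norm (f b - (y0 + y))"
        unfolding eq by (rule norm_triangle_ineq4)
      then show ?thesis
        using a(3) b(3) by (simp add: dist_norm)
    qed
    moreover have "b - a \<in> K"
      using K b(1) a(1) by (rule subspace_diff)
    ultimately show ?thesis
      by blast
  qed
  show thesis
  proof
    show "2 * real n / r \<ge> 0"
      using r by simp
    show "\<exists>x\<in>K. norm x \<le> 2 * real n / r * norm y \<and> norm (y - f x) \<le> norm y / 2" for y
    proof (cases "y = 0")
      case True
      then show ?thesis
        using K by (intro bexI[of _ 0]) (auto simp: f.zero subspace_0)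
    next
      case False
      define t where "t = norm y / r"
      have t: "t > 0" "norm y = t * r"
        using False r(1) by (auto simp: t_def)
      obtain x where x: "x \<in> K" "norm x \<le> 2 * real n" "norm ((1/t) *\<^sub>R y - f x) \<le> r / 2"
        using small[of "(1/t) *\<^sub>R y"] t r(1) by auto
      have "y - f (t *\<^sub>R x) = t *\<^sub>R ((1/t) *\<^sub>R y - f x)"
        using t by (simp add: f.scaleR scaleR_diff_right)
      then have "norm (y - f (t *\<^sub>R x)) \<le> t * (r / 2)"
        using x(3) t by simp
      moreover have "norm (t *\<^sub>R x) \<le> t * (2 * real n)"
        using x(2) t by simp
      moreover have "t * (2 * real n) = 2 * real n / r * norm y" "t * (r / 2) = norm y / 2"
        using r(1) by (simp_all add: t_def)
      moreover have "t *\<^sub>R x \<in> K"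
        using K x(1) by (rule subspace_scale)
      ultimately show ?thesis
        by (intro bexI[of _ "t *\<^sub>R x"]) simp_all
    qed
  qed
qed

text \<open>The successive approximation half of the open mapping theorem: the error of an approximate
  preimage is at most half of the target, so correcting it again and again gives a geometric
  series in \<open>K\<close> whose sum is an exact preimage.  It is stated for a closed subspace \<open>K\<close>
  because it is applied to \<open>UNIV \<times> N\<close>, where \<open>N\<close> is a subspace that is not a type.\<close>

lemma surj_bounded_preimage:
  fixes f :: "'a::banach \<Rightarrow> 'b::banach"
  assumes f: "bounded_linear f" and K: "subspace K" "closed K" and surj: "f ` K = UNIV"
  obtains c where "\<And>y. \<exists>x\<in>K. f x = y \<and> norm x \<le> c * norm y"
proof -
  interpret f: bounded_linear f by (fact f)
  obtain c where c: "c \<ge> 0"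
    "\<And>y. \<exists>x\<in>K. norm x \<le> c * norm y \<and> norm (y - f x) \<le> norm y / 2"
    by (rule surj_approximate_preimage[OF f K(1) surj], rule that)
  then obtain g where g: "\<And>y. g y \<in> K" "\<And>y. norm (g y) \<le> c * norm y"
      "\<And>y. norm (y - f (g y)) \<le> norm y / 2"
    by metis
  have "\<exists>x\<in>K. f x = y \<and> norm x \<le> (2 * c) * norm y" for y
  proof -
    define r where "r n = ((\<lambda>z. z - f (g z)) ^^ n) y" for n
    have r0: "r 0 = y" and rS: "r (Suc n) = r n - f (g (r n))" for n
      by (simp_all add: r_def)
    have rn: "norm (r n) \<le> norm y * (1/2) ^ n" for n
    proof (induction n)
      case (Suc n)
      then show ?case
        using g(3)[of "r n"] by (simp add: rS)
    qed (simp add: r0)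
    have bound: "norm (g (r n)) \<le> c * norm y * (1/2) ^ n" for n
      using order_trans[OF g(2) mult_left_mono[OF rn c(1)]] by (simp add: mult.assoc)
    have geo: "(\<lambda>n. c * norm y * (1/2) ^ n) sums (c * norm y * 2)"
      using sums_mult[OF geometric_sums[of "1/2::real"], of "c * norm y"] by simp
    have summ: "summable (\<lambda>n. norm (g (r n)))"
      by (rule summable_comparison_test'[OF sums_summable[OF geo], of 0]) (use bound in simp)
    then have sums: "(\<lambda>n. g (r n)) sums (\<Sum>n. g (r n))"
      by (rule summable_sums[OF summable_norm_cancel])
    have "r \<longlonglongrightarrow> 0"
    proof (rule Lim_null_comparison)
      show "(\<lambda>n. norm y * (1/2) ^ n) \<longlonglongrightarrow> 0"
        by (intro tendsto_mult_right_zero LIMSEQ_power_zero) simp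
    qed (simp add: rn)
    then have "(\<lambda>n. f (g (r n))) sums y"
      using telescope_sums'[of r 0] by (simp add: rS r0)
    then have "f (\<Sum>n. g (r n)) = y"
      using f.sums[OF sums] sums_unique2 by blast
    moreover have "(\<Sum>n. g (r n)) \<in> K"
      using sums unfolding sums_def
      by (rule Lim_in_closed_set[OF K(2) _ sequentially_bot, rotated])
        (auto intro!: always_eventually subspace_sum[OF K(1)] g(1))
    moreover have "norm (\<Sum>n. g (r n)) \<le> 2 * c * norm y"
      using order_trans[OF summable_norm[OF summ] suminf_le[OF bound summ sums_summable[OF geo]]]
        sums_unique[OF geo] by (simp add: mult.commute mult.left_commute)
    ultimately show ?thesis by blast
  qed
  then show thesis
    using that by blast
qed

text \<open>The map \<open>(x, n) \<longmapsto> f x + n\<close> sends \<open>UNIV \<times> N\<close> onto the whole space, so preimages can be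
  chosen with a linear norm bound.  If \<open>u n \<in> range f\<close> converges to \<open>y = f a + m\<close>, then the
  \<open>N\<close>-component of \<open>y - u n\<close> is always \<open>m\<close>, because the sum is direct, and by the bound it tends to
  \<open>0\<close>.\<close>

lemma closed_range_if_closed_complement:
  fixes f :: "'a::banach \<Rightarrow> 'b::banach"
  assumes f: "bounded_linear f" and N: "subspace N" "closed N"
    and triv: "range f \<inter> N = {0}" and sum: "\<And>y. \<exists>x. \<exists>n\<in>N. y = f x + n"
  shows "closed (range f)"
proof -
  interpret f: bounded_linear f by (fact f)
  have g: "bounded_linear (\<lambda>z. f (fst z) + snd z)"
    by (rule bounded_linear_add[OF bounded_linear_compose[OF f bounded_linear_fst] bounded_linear_snd])
  have "(\<lambda>z. f (fst z) + snd z) ` (UNIV \<times> N) = UNIV"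
    using sum by (fastforce simp: image_iff)
  then obtain c where c: "\<And>y. \<exists>z\<in>UNIV \<times> N. f (fst z) + snd z = y \<and> norm z \<le> c * norm y"
    using surj_bounded_preimage[OF g subspace_Times[OF subspace_UNIV N(1)] closed_Times[OF closed_UNIV N(2)]]
    by blast
  have "y \<in> range f" if x: "\<And>n. u n \<in> range f" and lim: "u \<longlonglongrightarrow> y" for u y
  proof -
    obtain a m where y: "y = f a + m" "m \<in> N"
      using sum by blast
    have le: "norm m \<le> c * norm (y - u n)" for n
    proof -
      obtain b k where bk: "k \<in> N" "f b + k = y - u n" "norm (b, k) \<le> c * norm (y - u n)"
        using c[of "y - u n"] by auto
      obtain v where v: "u n = f v"
        using x by blast
      have "m - k = f (b + v - a)"
        using bk(2) v y by (simp add: f.add f.diff algebra_simps)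
      moreover have "m - k \<in> N"
        using y(2) bk(1) N(1) by (simp add: subspace_diff)
      ultimately have "m - k = 0"
        using triv by blast
      then show ?thesis
        using bk(3) norm_snd_le[of k b] by simp
    qed
    have "(\<lambda>n. c * norm (y - u n)) \<longlonglongrightarrow> 0"
      using lim by (auto intro!: tendsto_eq_intros)
    then have "norm m \<le> 0"
      using le by (intro LIMSEQ_le_const) auto
    then show ?thesis
      using y by simp
  qed
  then show ?thesis
    unfolding closed_sequential_limits by blast
qed

section \<open>Spectra\<close>

lemma bounded_clinear_imp_bounded_linear: "bounded_clinear A \<Longrightarrow> bounded_linear A"
  by (simp add: bounded_clinear_def)

lemma bounded_clinear_imp_clinear:
  assumes "bounded_clinear A"
  shows "clinear A"
proof -
  interpret A: bounded_linear A
    using assms by (rule bounded_clinear_imp_bounded_linear)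
  show ?thesis
    using assms by unfold_locales (simp_all add: A.add bounded_clinear_def)
qed

lemma bounded_linear_scaleC: "bounded_linear (\<lambda>x. l *\<^sub>C x)"
proof (rule bounded_linear_intro)
  show "l *\<^sub>C (x + y) = l *\<^sub>C x + l *\<^sub>C y" for x y :: 'a
    by (rule scaleC_add_right)
  show "l *\<^sub>C (r *\<^sub>R x) = r *\<^sub>R (l *\<^sub>C x)" for r and x :: 'a
    by (simp only: scaleR_scaleC scaleC_scaleC mult.commute)
  show "norm (l *\<^sub>C x) \<le> norm x * cmod l" for x :: 'a
    by (simp add: norm_scaleC)
qed

lemma bounded_clinear_shift:
  assumes "bounded_clinear T"
  shows "bounded_clinear (shift T l)"
proof -
  have "bounded_linear (shift T l)"
    unfolding shift_def using assms bounded_linear_scaleC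
    by (intro bounded_linear_sub) (auto simp: bounded_clinear_def)
  moreover have "shift T l (c *\<^sub>C x) = c *\<^sub>C shift T l x" for c x
    using assms
    by (simp only: shift_def bounded_clinear_def complex_vector.scale_right_diff_distrib
        scaleC_scaleC mult.commute)
  ultimately show ?thesis
    by (simp add: bounded_clinear_def)
qed

lemma bounded_linear_funpow:
  fixes A :: "'a::real_normed_vector \<Rightarrow> 'a"
  assumes "bounded_linear A"
  shows "bounded_linear (A ^^ n)"
proof (induction n)
  case 0
  then show ?case
    using bounded_linear_ident by (simp add: id_def)
next
  case (Suc n)
  then show ?case
    using bounded_linear_compose[OF assms] by (simp add: comp_def)
qed

lemma subspace_if_complex_subspace:
  assumes "complex_vector.subspace N"
  shows "subspace N"
  using assms by (simp add: subspace_def complex_vector.subspace_def scaleR_scaleC)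

lemma closed_kern:
  assumes "bounded_linear A"
  shows "closed (kern A)"
  using closed_Collect_eq[OF linear_continuous_on[OF assms] continuous_on_const] 
  by (simp add: kern_def)

lemma closed_range_if_closed_complementary:
  fixes A :: "'a::complex_banach \<Rightarrow> 'a"
  assumes A: "bounded_linear A" and N: "complementary (range A) N" "closed N"
  shows "closed (range A)"
proof (rule closed_range_if_closed_complement)
  show "subspace N"
    using N(1) by (auto simp: complementary_def subspace_if_complex_subspace)
  show "range A \<inter> N = {0}" "\<exists>x. \<exists>n\<in>N. y = A x + n" for y
    using N(1) by (auto simp: complementary_def)
qed (use A N(2) in auto)

lemma nullity_eq_0_iff:
  assumes "clinear A"
  shows "nullity A = 0 \<longleftrightarrow> kern A = {0}"
proof
  assume "nullity A = 0"
  then show "kern A = {0}"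
    unfolding nullity_def by (rule cdim_eq_0D[OF subspace_kern[OF assms]])
next
  assume "kern A = {0}"
  then have "kern A = complex_vector.span {}"
    by simp
  then show "nullity A = 0"
    unfolding nullity_def using cdim_span_independent[OF complex_vector.independent_empty]
    by (simp add: zero_enat_def)
qed

lemma defect_eq_0_iff:
  assumes A: "clinear A"
  shows "defect A = 0 \<longleftrightarrow> range A = UNIV"
proof -
  have R: "complex_vector.subspace (range A)"
    using A by (rule subspace_image) simp
  obtain N where N: "complementary (range A) N"
    using ex_complementary[OF R] by blast
  have d: "defect A = cdim N"
    using codim_eq[OF R N] by (simp add: defect_def)
  show ?thesis
  proof
    assume "defect A = 0"
    then have "N = {0}"
      using d N cdim_eq_0D by (auto simp: complementary_def)
    then show "range A = UNIV"
      using N by (auto simp: complementary_def)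
  next
    assume "range A = UNIV"
    then have "N = complex_vector.span {}"
      using N by (auto simp: complementary_def)
    then show "defect A = 0"
      using d cdim_span_independent[OF complex_vector.independent_empty]
      by (simp add: zero_enat_def)
  qed
qed

text \<open>If no constant \<open>c\<close> works, normalising violations for \<open>c = 1 / (n + 1)\<close> gives a sequence of
  approximate eigenvectors.\<close>

lemma not_approx_point_spectrum_iff:
  assumes T: "bounded_clinear T"
  shows "l \<notin> approx_point_spectrum T \<longleftrightarrow> (\<exists>c>0. \<forall>x. c * norm x \<le> norm (shift T l x))"
proof
  interpret A: bounded_linear "shift T l"
    using bounded_clinear_imp_bounded_linear[OF bounded_clinear_shift[OF T]] .
  show "\<exists>c>0. \<forall>x. c * norm x \<le> norm (shift T l x)" if l: "l \<notin> approx_point_spectrum T"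
  proof (rule ccontr)
    assume no: "\<not> ?thesis"
    have "\<exists>x. norm x = 1 \<and> norm (shift T l x) \<le> inverse (real (Suc n))" for n
    proof -
      obtain x where x: "norm (shift T l x) < inverse (real (Suc n)) * norm x"
        using no by (meson inverse_positive_iff_positive not_le of_nat_0_less_iff zero_less_Suc)
      then have pos: "norm x > 0"
        using norm_ge_zero[of "shift T l x"] by (auto simp: A.zero)
      have "norm (shift T l (x /\<^sub>R norm x)) = norm (shift T l x) / norm x"
        using pos by (simp add: A.scaleR divide_inverse mult.commute)
      also have "\<dots> \<le> inverse (real (Suc n))"
        using x pos by (simp only: pos_divide_le_eq less_imp_le)
      finally show ?thesis
        using pos by (intro exI[of _ "x /\<^sub>R norm x"]) simp
    qed
    then obtain x where x: "\<And>n. norm (x n) = 1"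
        "\<And>n. norm (shift T l (x n)) \<le> inverse (real (Suc n))"
      by metis
    have "(\<lambda>n. shift T l (x n)) \<longlonglongrightarrow> 0"
      by (rule Lim_null_comparison[OF _ LIMSEQ_inverse_real_of_nat]) (use x(2) in simp)
    then show False
      using l x(1) by (auto simp: approx_point_spectrum_def)
  qed
  show "l \<notin> approx_point_spectrum T" if bb: "\<exists>c>0. \<forall>x. c * norm x \<le> norm (shift T l x)"
  proof
    assume "l \<in> approx_point_spectrum T"
    then obtain x where x: "\<And>n. norm (x n) = 1" "(\<lambda>n. shift T l (x n)) \<longlonglongrightarrow> 0"
      by (auto simp: approx_point_spectrum_def)
    obtain c where c: "c > 0" "\<And>x. c * norm x \<le> norm (shift T l x)"
      using bb by blast
    have "c \<le> norm (shift T l (x n))" for n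
      using c(2)[of "x n"] x(1) by simp
    then have "c \<le> 0"
      using tendsto_norm_zero[OF x(2)] by (intro LIMSEQ_le_const) auto
    then show False
      using c(1) by simp
  qed
qed

lemma kern_eq_0_if_bounded_below:
  assumes "bounded_linear A" "c > 0" "\<And>x. c * norm x \<le> norm (A x)"
  shows "kern A = {0}"
proof -
  have "x = 0" if "A x = 0" for x
    using assms(2) assms(3)[of x] that by (simp add: mult_le_0_iff)
  then show ?thesis
    using linear_simps(3)[OF assms(1)] by (auto simp: kern_def)
qed

lemma closed_range_if_bounded_below:
  fixes A :: "'a::banach \<Rightarrow> 'b::real_normed_vector"
  assumes "bounded_linear A" "c > 0" "\<And>x. c * norm x \<le> norm (A x)"
  shows "closed (range A)"
  using complete_isometric_image[OF assms(2) subspace_UNIV assms(1)] assms(3)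
  by (simp add: complete_UNIV complete_imp_closed)

text \<open>The inverse map is bounded by the reciprocal of the lower bound.\<close>

lemma invertible_op_if_bounded_below_surj:
  assumes A: "bounded_clinear A" and c: "c > 0" "\<And>x. c * norm x \<le> norm (A x)"
    and surj: "range A = UNIV"
  shows "invertible_op A"
proof -
  interpret A: Vector_Spaces.linear scaleC scaleC A
    using A by (rule bounded_clinear_imp_clinear)
  have "inj A"
    using kern_eq_0_if_bounded_below[OF bounded_clinear_imp_bounded_linear[OF A] c]
    by (auto simp: A.inj_iff_eq_0 kern_def)
  define S where "S = inv A"
  have SA: "S (A x) = x" and AS: "A (S x) = x" for x
    using \<open>inj A\<close> surj by (simp_all add: S_def surj_f_inv_f)
  have add: "S (x + y) = S x + S y" for x y
    using SA[of "S x + S y"] by (simp add: A.add AS)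
  have scale: "S (a *\<^sub>C x) = a *\<^sub>C S x" for a x
    using SA[of "a *\<^sub>C S x"] by (simp add: A.scale AS)
  have "norm (S x) \<le> norm x * (1 / c)" for x
    using c(2)[of "S x"] c(1) by (simp add: AS field_simps)
  then have "bounded_linear S"
    using add scale by (intro bounded_linear_intro[where K = "1 / c"]) (auto simp: scaleR_scaleC)
  then have "bounded_clinear S"
    using scale by (simp add: bounded_clinear_def)
  then show ?thesis
    unfolding invertible_op_def using SA AS by (intro exI[of _ S]) (auto simp: fun_eq_iff)
qed

lemma approx_point_spectrum_subset_spectrum:
  assumes T: "bounded_clinear T"
  shows "approx_point_spectrum T \<subseteq> spectrum T"
proof
  fix l assume l: "l \<in> approx_point_spectrum T"
  have False if inv: "invertible_op (shift T l)"
  proof -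
    obtain S where S: "bounded_linear S" "S \<circ> shift T l = id"
      using inv unfolding invertible_op_def bounded_clinear_def by blast
    obtain K where K: "K > 0" "\<And>x. norm (S x) \<le> norm x * K"
      using bounded_linear.pos_bounded[OF S(1)] by blast
    have "1 / K * norm x \<le> norm (shift T l x)" for x
      using K(2)[of "shift T l x"] K(1) fun_cong[OF S(2), of x] by (simp add: pos_divide_le_eq)
    then show False
      using l K(1) not_approx_point_spectrum_iff[OF T] by (meson zero_less_divide_1_iff)
  qed
  then show "l \<in> spectrum T"
    by (auto simp: spectrum_def)
qed

lemma fredholm_index_eq_0_iff:
  assumes "nullity A < \<infinity>"
  shows "fredholm_index A = 0 \<longleftrightarrow> nullity A = defect A"
proof -
  obtain n where n: "nullity A = enat n"
    using assms by auto
  show ?thesis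
    by (cases "defect A") (simp_all add: fredholm_index_def n)
qed

lemma not_Weyl_spectrum_iff:
  "l \<notin> Weyl_spectrum T \<longleftrightarrow> closed (range (shift T l)) \<and>
     nullity (shift T l) < \<infinity> \<and> nullity (shift T l) = defect (shift T l)"
  using fredholm_index_eq_0_iff[of "shift T l"]
  unfolding Weyl_spectrum_def Fredholm_def upper_semi_Fredholm_def mem_Collect_eq not_not
  by metis

lemma upper_semi_Weyl_spectrum_subset_Weyl_spectrum:
  "upper_semi_Weyl_spectrum T \<subseteq> Weyl_spectrum T"
  unfolding upper_semi_Weyl_spectrum_def Weyl_spectrum_def Fredholm_def
  by (rule Collect_mono) (metis order_refl)

lemma upper_semi_Weyl_spectrum_subset_approx_point_spectrum:
  assumes T: "bounded_clinear T"
  shows "upper_semi_Weyl_spectrum T \<subseteq> approx_point_spectrum T"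
proof
  fix l assume l: "l \<in> upper_semi_Weyl_spectrum T"
  note A = bounded_clinear_shift[OF T, of l]
  show "l \<in> approx_point_spectrum T"
  proof (rule ccontr)
    assume "l \<notin> approx_point_spectrum T"
    then obtain c where c: "c > 0" "\<And>x. c * norm x \<le> norm (shift T l x)"
      using not_approx_point_spectrum_iff[OF T] by blast
    have "nullity (shift T l) = 0"
      using kern_eq_0_if_bounded_below[OF bounded_clinear_imp_bounded_linear[OF A] c]
      by (simp add: nullity_eq_0_iff[OF bounded_clinear_imp_clinear[OF A]])
    moreover have "closed (range (shift T l))"
      using bounded_clinear_imp_bounded_linear[OF A] c by (rule closed_range_if_bounded_below)
    ultimately show False
      using l
      by (cases "defect (shift T l)")
        (auto simp: upper_semi_Weyl_spectrum_def upper_semi_Fredholm_def fredholm_index_def)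
  qed
qed

lemma Weyl_spectrum_subset_spectrum:
  assumes T: "bounded_clinear T"
  shows "Weyl_spectrum T \<subseteq> spectrum T"
proof
  fix l assume l: "l \<in> Weyl_spectrum T"
  note A = bounded_clinear_imp_clinear[OF bounded_clinear_shift[OF T, of l]]
  have False if inv: "invertible_op (shift T l)"
  proof -
    obtain S where S: "S \<circ> shift T l = id" "shift T l \<circ> S = id"
      using inv unfolding invertible_op_def by blast
    then have b: "bij (shift T l)"
      by (rule o_bij)
    have zero: "shift T l 0 = 0"
      using Vector_Spaces.linear.axioms(3)[OF A] A by (simp add: module_hom.zero)
    have "x = 0" if "shift T l x = 0" for x
      using b that zero by (metis bij_def injD)
    then have "kern (shift T l) = {0}"
      using zero by (auto simp: kern_def)
    then have "nullity (shift T l) = 0" "defect (shift T l) = 0"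
      using b by (simp_all add: nullity_eq_0_iff[OF A] defect_eq_0_iff[OF A] bij_def)
    then show False
      using l b not_Weyl_spectrum_iff[of l T] by (simp add: bij_def)
  qed
  then show "l \<in> spectrum T"
    by (auto simp: spectrum_def)
qed

text \<open>Here \<open>T - l I\<close> is bounded below but not invertible, so it is injective but not surjective:
  nullity \<open>0\<close> and a positive defect.\<close>

lemma spectrum_diff_approx_point_spectrum_subset_Weyl_spectrum:
  assumes T: "bounded_clinear T"
  shows "spectrum T - approx_point_spectrum T \<subseteq> Weyl_spectrum T"
proof
  fix l assume l: "l \<in> spectrum T - approx_point_spectrum T"
  note A = bounded_clinear_shift[OF T, of l]
  obtain c where c: "c > 0" "\<And>x. c * norm x \<le> norm (shift T l x)"
    using l not_approx_point_spectrum_iff[OF T] by blast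
  have n: "nullity (shift T l) = 0"
    using kern_eq_0_if_bounded_below[OF bounded_clinear_imp_bounded_linear[OF A] c]
    by (simp add: nullity_eq_0_iff[OF bounded_clinear_imp_clinear[OF A]])
  have "range (shift T l) \<noteq> UNIV"
    using l invertible_op_if_bounded_below_surj[OF A c] by (auto simp: spectrum_def)
  then have "defect (shift T l) \<noteq> nullity (shift T l)"
    using n by (simp add: defect_eq_0_iff[OF bounded_clinear_imp_clinear[OF A]])
  then show "l \<in> Weyl_spectrum T"
    using not_Weyl_spectrum_iff[of l T] by metis
qed

section \<open>Poles and left poles\<close>

text \<open>At a pole the ranges are stationary at the ascent \<open>p\<close>, so \<open>range (A ^^ (p + 1)) = range (A ^^ p)\<close>,
  which has the closed complement \<open>kern (A ^^ p)\<close>.  The pole lies in the approximate point spectrum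
  because an operator that is bounded below has ascent \<open>0\<close>; with finite descent it would be
  surjective, hence invertible.\<close>

lemma poles_subset_left_poles:
  assumes T: "bounded_clinear T"
  shows "poles T \<subseteq> left_poles T"
proof
  fix l assume l: "l \<in> poles T"
  define A where "A = shift T l"
  have bA: "bounded_clinear A"
    using bounded_clinear_shift[OF T] by (simp add: A_def)
  have blA: "bounded_linear A"
    using bA by (rule bounded_clinear_imp_bounded_linear)
  have A: "clinear A"
    using bA by (rule bounded_clinear_imp_clinear)
  obtain p where p: "ascent A = enat p"
    using l by (auto simp: poles_def A_def)
  obtain q where q: "range (A ^^ q) = range (A ^^ Suc q)"
    using l descent_finite_iff[of A] by (auto simp: poles_def A_def)
  note k = kern_stable_at_ascent[OF p]
  note r = range_stable_if_kern_stable[OF A k q]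
  have "closed (range (A ^^ p))"
    using closed_range_if_closed_complementary[OF bounded_linear_funpow[OF blA]
        range_funpow_complementary_kern[OF A k r] closed_kern[OF bounded_linear_funpow[OF blA]]] .
  then have "closed (range (A ^^ (p + 1)))"
    using r by simp
  moreover have "l \<in> approx_point_spectrum T"
  proof (rule ccontr)
    assume "l \<notin> approx_point_spectrum T"
    then obtain c where c: "c > 0" "\<And>x. c * norm x \<le> norm (A x)"
      using not_approx_point_spectrum_iff[OF T] by (auto simp: A_def)
    have "kern A = {0}"
      using blA c by (rule kern_eq_0_if_bounded_below)
    then have "kern (A ^^ 0) = kern (A ^^ Suc 0)"
      by (auto simp: kern_def)
    then have "range (A ^^ 0) = range (A ^^ Suc 0)"
      by (rule range_stable_if_kern_stable[OF A _ q])
    then have "range A = UNIV"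
      by simp
    then show False
      using l invertible_op_if_bounded_below_surj[OF bA c] by (simp add: poles_def spectrum_def A_def)
  qed
  ultimately show "l \<in> left_poles T"
    using p by (auto simp: left_poles_def A_def)
qed

text \<open>Finite ascent and index \<open>0\<close> force finite descent.\<close>

lemma left_pole_diff_Weyl_spectrum_subset_poles:
  assumes T: "bounded_clinear T"
  shows "left_poles T - Weyl_spectrum T \<subseteq> poles T"
proof
  fix l assume l: "l \<in> left_poles T - Weyl_spectrum T"
  note A = bounded_clinear_imp_clinear[OF bounded_clinear_shift[OF T, of l]]
  obtain p where p: "ascent (shift T l) = enat p"
    using l by (auto simp: left_poles_def)
  have "range (shift T l ^^ p) = range (shift T l ^^ Suc p)"
    using l range_stable_iff_nullity_eq_defect[OF A _ kern_stable_at_ascent[OF p]]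
      not_Weyl_spectrum_iff[of l T] by blast
  then have "descent (shift T l) < \<infinity>"
    using descent_finite_iff[of "shift T l"] by blast
  then show "l \<in> poles T"
    using l p approx_point_spectrum_subset_spectrum[OF T] by (auto simp: poles_def left_poles_def)
qed

text \<open>Finite ascent and descent together with finite nullity force index \<open>0\<close>, so a pole can lie in
  the Weyl spectrum only by failing to be upper semi-Fredholm.\<close>

lemma poles_Int_Weyl_spectrum_subset_upper_semi_Weyl_spectrum:
  assumes T: "bounded_clinear T"
  shows "poles T \<inter> Weyl_spectrum T \<subseteq> upper_semi_Weyl_spectrum T"
proof
  fix l assume l: "l \<in> poles T \<inter> Weyl_spectrum T"
  note A = bounded_clinear_imp_clinear[OF bounded_clinear_shift[OF T, of l]]
  obtain p where k: "kern (shift T l ^^ p) = kern (shift T l ^^ Suc p)"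
    using l ascent_finite_iff[of "shift T l"] unfolding poles_def by blast
  obtain q where "range (shift T l ^^ q) = range (shift T l ^^ Suc q)"
    using l descent_finite_iff[of "shift T l"] unfolding poles_def by blast
  note r = range_stable_if_kern_stable[OF A k this]
  have "\<not> (nullity (shift T l) < \<infinity> \<and> closed (range (shift T l)))"
    using l r range_stable_iff_nullity_eq_defect[OF A _ k] not_Weyl_spectrum_iff[of l T] by blast
  then show "l \<in> upper_semi_Weyl_spectrum T"
    by (auto simp: upper_semi_Weyl_spectrum_def upper_semi_Fredholm_def)
qed

theorem theorem3p12:
  fixes T :: "'a::complex_banach \<Rightarrow> 'a"
  assumes "\<not> finite_cdim (UNIV :: 'a set)"
    and "bounded_clinear T"
  shows
    "(property_UW_Pi T \<and> left_poles T \<inter> upper_semi_Weyl_spectrum T = {} \<longleftrightarrow>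
      property_Z_Pi_a T \<and>
        Weyl_spectrum T - upper_semi_Weyl_spectrum T = spectrum T - approx_point_spectrum T) \<and>
     (property_Z_Pi_a T \<and>
        Weyl_spectrum T - upper_semi_Weyl_spectrum T = spectrum T - approx_point_spectrum T \<longleftrightarrow>
      property_Z_Pi_a T \<and> Delta_a T \<inter> Weyl_spectrum T = {})"
proof -
  note T = assms(2)
  note incl = approx_point_spectrum_subset_spectrum[OF T] Weyl_spectrum_subset_spectrum[OF T]
    upper_semi_Weyl_spectrum_subset_Weyl_spectrum[of T]
    upper_semi_Weyl_spectrum_subset_approx_point_spectrum[OF T]
    spectrum_diff_approx_point_spectrum_subset_Weyl_spectrum[OF T]
  have ii_iff_iii: "Weyl_spectrum T - upper_semi_Weyl_spectrum T =
      spectrum T - approx_point_spectrum T \<longleftrightarrow> Delta_a T \<inter> Weyl_spectrum T = {}"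
    unfolding Delta_a_def using incl by blast
  have Delta: "Delta T \<subseteq> Delta_a T"
    unfolding Delta_def Delta_a_def using incl by blast
  have "left_poles T \<subseteq> approx_point_spectrum T"
    by (auto simp: left_poles_def)
  note poles = this poles_subset_left_poles[OF T] left_pole_diff_Weyl_spectrum_subset_poles[OF T]
    poles_Int_Weyl_spectrum_subset_upper_semi_Weyl_spectrum[OF T]
  have i_imp_iii: "property_Z_Pi_a T \<and> Delta_a T \<inter> Weyl_spectrum T = {}"
    if "property_UW_Pi T" "left_poles T \<inter> upper_semi_Weyl_spectrum T = {}"
  proof -
    have eq: "Delta_a T = poles T"
      using that(1) by (simp add: property_UW_Pi_def)
    have disj: "Delta_a T \<inter> Weyl_spectrum T = {}"
      using eq poles(4) by (auto simp: Delta_a_def)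
    then have "Delta_a T \<subseteq> Delta T"
      using incl(1) by (auto simp: Delta_def Delta_a_def)
    moreover have "left_poles T = poles T"
      using that(2) poles(1,2) eq by (auto simp: Delta_a_def)
    ultimately show ?thesis
      using Delta eq disj by (auto simp: property_Z_Pi_a_def)
  qed
  have iii_imp_i: "property_UW_Pi T \<and> left_poles T \<inter> upper_semi_Weyl_spectrum T = {}"
    if "property_Z_Pi_a T" "Delta_a T \<inter> Weyl_spectrum T = {}"
  proof -
    have eq: "Delta T = left_poles T"
      using that(1) by (simp add: property_Z_Pi_a_def)
    have "Delta_a T = Delta T"
      using Delta that(2) incl(1) by (auto simp: Delta_def Delta_a_def)
    moreover have "left_poles T = poles T"
      using eq poles(2,3) by (auto simp: Delta_def)
    moreover have "left_poles T \<inter> upper_semi_Weyl_spectrum T = {}"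
      using eq incl(3) by (auto simp: Delta_def)
    ultimately show ?thesis
      using eq by (simp add: property_UW_Pi_def)
  qed
  show ?thesis
    using ii_iff_iii i_imp_iii iii_imp_i by blast
qed

end
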